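(* For each integer $k\ge 4$ there is a constant $c=c(k)>0$ such that for all sufficiently large $n$, $$r_k(k+2,n)\ge \operatorname{twr}_{k-1}(cn).$$
   Context: A $k$-uniform hypergraph ($k$-graph) $H$ consists of a vertex set $V(H)$ and a collection of $k$-element subsets of $V(H)$ called edges. $K_s^{(k)}$ denotes the complete $k$-graph on $s$ vertices. An independent set of $H$ is a set of vertices containing no edge of $H$. The off-diagonal Ramsey number $r_k(s,n)$ is the smallest integer $N$ such that every $k$-graph on $N$ vertices contains either a copy of $K_s^{(k)}$ or an independent set of size $n$. The tower function is defined by $\operatorname{twr}_1(x)=x$ and $\operatorname{twr}_{i+1}(x)=2^{\operatorname{twr}_i(x)}$ for $i\ge 1$. *)

theory Defs
  imports Complex_Main "HOL-Library.Ramsey"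
begin

(* The edges of a k-graph on the vertex set V form a subset of [V]^k, the set of
   k-element subsets of V. *)
definition uniform_hypergraph :: "nat \<Rightarrow> 'a set \<Rightarrow> 'a set set \<Rightarrow> bool" where
  "uniform_hypergraph k V E \<longleftrightarrow> finite V \<and> E \<subseteq> [V]\<^bsup>k\<^esup>"

definition contains_complete :: "nat \<Rightarrow> 'a set \<Rightarrow> 'a set set \<Rightarrow> nat \<Rightarrow> bool" where
  "contains_complete k V E s \<longleftrightarrow> (\<exists>S. S \<subseteq> V \<and> finite S \<and> card S = s \<and> [S]\<^bsup>k\<^esup> \<subseteq> E)"

definition independent_set :: "'a set \<Rightarrow> 'a set set \<Rightarrow> 'a set \<Rightarrow> bool" where
  "independent_set V E I \<longleftrightarrow> I \<subseteq> V \<and> (\<forall>e\<in>E. \<not> e \<subseteq> I)"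

definition has_independent_set :: "'a set \<Rightarrow> 'a set set \<Rightarrow> nat \<Rightarrow> bool" where
  "has_independent_set V E n \<longleftrightarrow> (\<exists>I. independent_set V E I \<and> finite I \<and> card I = n)"

(* Vertices are natural numbers, which is no restriction up to isomorphism. *)
definition ramsey_property :: "nat \<Rightarrow> nat \<Rightarrow> nat \<Rightarrow> nat \<Rightarrow> bool" where
  "ramsey_property k s n N \<longleftrightarrow>
     (\<forall>(V :: nat set) E. uniform_hypergraph k V E \<and> card V = N \<longrightarrow>
        contains_complete k V E s \<or> has_independent_set V E n)"

definition ramsey_number :: "nat \<Rightarrow> nat \<Rightarrow> nat \<Rightarrow> nat" where
  "ramsey_number k s n = (LEAST N. ramsey_property k s n N)"

(* By Ramsey's theorem the minimum above is attained. *)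
lemma ramsey_property_exists: "\<exists>N. ramsey_property k s n N"
proof -
  obtain N :: nat where N: "partn_lst {..<N} [s, n] k"
    using ramsey2_full by blast
  have "contains_complete k V E s \<or> has_independent_set V E n"
    if H: "uniform_hypergraph k V E" and cV: "card V = N" for V :: "nat set" and E
  proof -
    have finV: "finite V" and EV: "E \<subseteq> [V]\<^bsup>k\<^esup>"
      using H by (auto simp: uniform_hypergraph_def)
    obtain h where h: "bij_betw h {..<N} V"
      using ex_bij_betw_nat_finite[OF finV] cV by (auto simp: atLeast0LessThan)
    define f where "f X = (if h ` X \<in> E then 0 else 1 :: nat)" for X
    have "f \<in> [{..<N}]\<^bsup>k\<^esup> \<rightarrow> {..<2}"
      by (auto simp: f_def)
    then obtain i M where i: "i < 2" and M: "M \<in> [{..<N}]\<^bsup>([s, n] ! i)\<^esup>"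
      and mono: "f ` [M]\<^bsup>k\<^esup> \<subseteq> {i}"
      using partn_lstE[OF N, of f 2] by (metis length_Cons list.size(3) One_nat_def Suc_1)
    have MN: "M \<subseteq> {..<N}" and finM: "finite M" and cM: "card M = [s, n] ! i"
      using M by (auto simp: nsets_def)
    have inj: "inj_on h M" and sub: "h ` M \<subseteq> V"
      using h MN by (auto simp: bij_betw_def intro: inj_on_subset)
    have card: "card (h ` M) = [s, n] ! i" and fin: "finite (h ` M)"
      using inj cM finM by (auto simp: card_image)
    have col: "i = (if e \<in> E then 0 else 1)" if e: "e \<in> [h ` M]\<^bsup>k\<^esup>" for e
    proof -
      obtain X where X: "X \<in> [M]\<^bsup>k\<^esup>" and eX: "e = h ` X"
      proof -
        obtain X where X: "X \<subseteq> M" "e = h ` X"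
          using e by (auto simp: nsets_def subset_image_iff)
        moreover have "card X = k"
          using e X card_image[OF inj_on_subset[OF inj X(1)]] by (simp add: nsets_def)
        ultimately show ?thesis
          using finM that[of X] finite_subset by (auto simp: nsets_def)
      qed
      then have "f X = i"
        using mono by blast
      then show ?thesis
        using eX by (simp add: f_def)
    qed
    consider "i = 0" | "i = 1"
      using i by linarith
    then show ?thesis
    proof cases
      case 1
      have "[h ` M]\<^bsup>k\<^esup> \<subseteq> E"
        using col 1 by (metis subsetI zero_neq_one)
      then show ?thesis
        using sub card fin 1 by (auto simp: contains_complete_def)
    next
      case 2
      have "\<not> e \<subseteq> h ` M" if e: "e \<in> E" for e
      proof
        assume "e \<subseteq> h ` M"
        then have "e \<in> [h ` M]\<^bsup>k\<^esup>"
          using e EV by (auto simp: nsets_def)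
        then show False
          using col[of e] e 2 by simp
      qed
      then show ?thesis
        using sub card fin 2 by (auto simp: has_independent_set_def independent_set_def)
    qed
  qed
  then show ?thesis
    unfolding ramsey_property_def by blast
qed

(* The tower function starts at index 1; its value at index 0 is a dummy. *)
fun twr :: "nat \<Rightarrow> real \<Rightarrow> real" where
  "twr 0 x = x"
| "twr (Suc 0) x = x"
| "twr (Suc (Suc i)) x = 2 powr twr (Suc i) x"

end

theory Submission
  imports Defs "HOL-Library.Disjoint_Sets" "HOL-Number_Theory.Cong"
begin

text \<open>
  Let \<open>\<delta>(u, v)\<close> be the highest bit in which \<open>u\<close> and \<open>v\<close> differ. A set of vertices in \<open>{0, \<dots>, 2\<^sup>N - 1}\<close>
  spans a binary tree whose inner nodes carry labels \<open>\<delta> < N\<close> decreasing from the root, and a set on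
  which \<open>\<delta>\<close> is monotone is a comb, determined by its label set.

  For \<open>k = 4\<close> take a random two-colouring \<open>\<phi>\<close> of the pairs of \<open>N = 2\<^sup>j\<close> labels. Combs are edges if
  their three labels \<open>x > y > z\<close> satisfy \<open>\<phi>(x,y) = \<phi>(y,z) = 0\<close> and \<open>\<phi>(x,z) = 1\<close>. A balanced quadruple
  with root \<open>x\<close> fails to be an edge only if \<open>\<phi>(x,\<cdot>)\<close> is 0 at the left and 1 at the right inner node, and the
  two bent paths are edges exactly for the colours that two nested branch nodes would then force.
  Hence an independent set has no two nested branch nodes, so it consists of boundedly many
  combs, each of length \<open>O(j)\<close>. In a comb edge \<open>\<phi>(x,\<cdot>)\<close> takes both values below the root, which is
  incompatible with complete sets of size six.

  For \<open>k \<ge> 4\<close> the uniformity is raised by taking as edges the combs whose label set is an edge, together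
  with all sets starting with \<open>\<delta>\<^sub>1 < \<delta>\<^sub>2 > \<delta>\<^sub>3 < \<delta>\<^sub>4\<close>. This pattern starts differently after
  deleting the first vertex, so that complete sets are combs; and a large set without it contains
  a long comb. Thus \<open>n\<close> grows only by a constant factor while the number of vertices is exponentiated.
\<close>

section \<open>Binary step-up of vertex sets\<close>

text \<open>\<open>delta u v \<le> i\<close> means agreement after dropping the lowest
  \<open>i + 1\<close> bits, so bits are handled through quotients only. For \<open>u = v\<close>
  the value is the default 0.\<close>

definition delta :: "nat \<Rightarrow> nat \<Rightarrow> nat" where
  "delta u v = (LEAST i. u div 2 ^ Suc i = v div 2 ^ Suc i)"

lemma delta_le_iff: "delta u v \<le> i \<longleftrightarrow> u div 2 ^ Suc i = v div 2 ^ Suc i"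
proof
  have less: "w < 2 ^ Suc (max u v)" if "w = u \<or> w = v" for w :: nat
  proof -
    have "w < 2 ^ w" by simp
    also have "\<dots> \<le> 2 ^ Suc (max u v)" using that by (intro power_increasing) auto
    finally show ?thesis .
  qed
  have "u div 2 ^ Suc (max u v) = v div 2 ^ Suc (max u v)"
    using less[of u] less[of v] by (simp del: power_Suc)
  then have eq: "u div 2 ^ Suc (delta u v) = v div 2 ^ Suc (delta u v)"
    unfolding delta_def by (rule LeastI)
  assume "delta u v \<le> i"
  then have pow: "(2::nat) ^ Suc i = 2 ^ Suc (delta u v) * 2 ^ (i - delta u v)"
    by (simp flip: power_add)
  show "u div 2 ^ Suc i = v div 2 ^ Suc i"
    unfolding pow div_mult2_eq eq ..
next
  assume "u div 2 ^ Suc i = v div 2 ^ Suc i"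
  then show "delta u v \<le> i"
    unfolding delta_def by (rule Least_le)
qed

lemma delta_commute: "delta u v = delta v u"
  by (simp add: delta_def eq_commute)

text \<open>Division is monotone, so if the quotients of \<open>u\<close> and \<open>w\<close>
  agree, that of \<open>v\<close> is squeezed between them; hence both sides have the same upper
  bounds.\<close>

lemma delta_max:
  assumes "u \<le> v" "v \<le> w"
  shows "delta u w = max (delta u v) (delta v w)"
proof -
  have "delta u w \<le> i \<longleftrightarrow> max (delta u v) (delta v w) \<le> i" for i
    using div_le_mono[OF assms(1), of "2 ^ Suc i"] div_le_mono[OF assms(2), of "2 ^ Suc i"]
    unfolding max.bounded_iff delta_le_iff by linarith
  then show ?thesis
    by (meson antisym order_refl)
qed

text \<open>At the highest differing bit the smaller number has 0 and the larger has 1; a common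
  value would give \<open>v\<close> both bits.\<close>

lemma delta_neq:
  assumes "u < v" "v < w"
  shows "delta u v \<noteq> delta v w"
proof
  assume eq: "delta u v = delta v w"
  define i where "i = delta u v"
  have less: "x div 2 ^ i < y div 2 ^ i" if "x < y" "delta x y = i" for x y
  proof (cases i)
    case 0
    then show ?thesis using that by simp
  next
    case (Suc j)
    then have "x div 2 ^ i \<noteq> y div 2 ^ i"
      using that delta_le_iff[of x y j] by simp
    then show ?thesis
      using div_le_mono[of x y "2 ^ i"] that by simp
  qed
  have half: "x div 2 ^ i div 2 = y div 2 ^ i div 2" if "delta x y = i" for x y
    using that delta_le_iff[of x y i] by (simp flip: div_mult2_eq add: mult.commute)
  show False
    using less[of u v] less[of v w] half[of u v] half[of v w] assms eq
    unfolding i_def by linarith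
qed

lemma delta_less:
  assumes "u < 2 ^ N" "v < 2 ^ N" "u \<noteq> v"
  shows "delta u v < N"
proof (cases N)
  case 0
  then show ?thesis using assms by simp
next
  case (Suc M)
  then have "delta u v \<le> M"
    using assms unfolding delta_le_iff by (simp del: power_Suc)
  then show ?thesis using Suc by simp
qed

lemma delta_valley_neq:
  assumes "a < b" "b < c" "c < d" "delta b c < delta c d"
  shows "delta a b \<noteq> delta c d"
proof -
  have "delta b d = delta c d"
    using assms delta_max[of b c d] by simp
  then show ?thesis
    using delta_neq[of a b d] assms by simp
qed

section \<open>Combs and their label sets\<close>

definition descending :: "nat set \<Rightarrow> bool" where
  "descending X \<longleftrightarrow> (\<forall>u\<in>X. \<forall>v\<in>X. \<forall>w\<in>X. u < v \<and> v < w \<longrightarrow> delta v w < delta u v)"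

definition ascending :: "nat set \<Rightarrow> bool" where
  "ascending X \<longleftrightarrow> (\<forall>u\<in>X. \<forall>v\<in>X. \<forall>w\<in>X. u < v \<and> v < w \<longrightarrow> delta u v < delta v w)"

definition comb :: "nat set \<Rightarrow> bool" where
  "comb X \<longleftrightarrow> descending X \<or> ascending X"

definition labels :: "nat set \<Rightarrow> nat set" where
  "labels X = {delta u v | u v. u \<in> X \<and> v \<in> X \<and> u < v}"

lemma descendingD: "descending X \<Longrightarrow> {u, v, w} \<subseteq> X \<Longrightarrow> u < v \<Longrightarrow> v < w \<Longrightarrow> delta v w < delta u v"
  by (auto simp: descending_def)

lemma ascendingD: "ascending X \<Longrightarrow> {u, v, w} \<subseteq> X \<Longrightarrow> u < v \<Longrightarrow> v < w \<Longrightarrow> delta u v < delta v w"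
  by (auto simp: ascending_def)

lemma comb_subset: "comb X \<Longrightarrow> Y \<subseteq> X \<Longrightarrow> comb Y"
  unfolding comb_def descending_def ascending_def by (meson subsetD)

lemma labels_subset: "X \<subseteq> {..<2 ^ N} \<Longrightarrow> labels X \<subseteq> {..<N}"
  by (fastforce simp: labels_def intro: delta_less)

text \<open>In a descending set a label depends only on the smaller vertex, so the maximum can be
  the partner of all others; in an ascending set the larger vertex and the minimum take these roles.
  The pivot turns sets of labels back into sets of vertices.\<close>

lemma comb_pivot:
  assumes "finite X" "X \<noteq> {}" "comb X"
  obtains p where "p \<in> X" "inj_on (\<lambda>u. delta u p) (X - {p})"
    "\<And>Y. Y \<subseteq> X \<Longrightarrow> p \<in> Y \<Longrightarrow> labels Y = (\<lambda>u. delta u p) ` (Y - {p})"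
proof -
  consider "descending X" | "ascending X"
    using assms by (auto simp: comb_def)
  then show thesis
  proof cases
    case 1
    define p where "p = Max X"
    have p: "p \<in> X" "\<And>u. u \<in> X \<Longrightarrow> u \<le> p"
      using assms by (auto simp: p_def)
    have eq: "delta u v = delta u p" if "u \<in> X" "v \<in> X" "u < v" for u v
    proof (cases "v = p")
      case False
      then show ?thesis
        using delta_max[of u v p] p that descendingD[OF 1, of u v p]
        by (metis insert_subset empty_subsetI le_neq_implies_less less_imp_le max.absorb1)
    qed simp
    have less: "delta v p < delta u p" if "u \<in> X" "v \<in> X" "u < v" "v \<noteq> p" for u v
      using descendingD[OF 1, of u v p] p that eq[of u v] by (simp add: le_neq_implies_less)
    show thesis
    proof (rule that[OF p(1)])
      show "inj_on (\<lambda>u. delta u p) (X - {p})"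
        by (rule inj_onI) (metis Diff_iff insertI1 less less_irrefl linorder_neqE_nat)
      show "labels Y = (\<lambda>u. delta u p) ` (Y - {p})" if "Y \<subseteq> X" "p \<in> Y" for Y
      proof
        show "labels Y \<subseteq> (\<lambda>u. delta u p) ` (Y - {p})"
        proof
          fix x assume "x \<in> labels Y"
          then obtain u v where "x = delta u v" "u \<in> Y" "v \<in> Y" "u < v"
            by (auto simp: labels_def)
          then show "x \<in> (\<lambda>u. delta u p) ` (Y - {p})"
            using eq[of u v] p(2)[of v] that by (intro image_eqI[of _ _ u]) auto
        qed
        show "(\<lambda>u. delta u p) ` (Y - {p}) \<subseteq> labels Y"
          using that p(2) by (force simp: labels_def le_neq_implies_less)
      qed
    qed
  next
    case 2
    define p where "p = Min X"
    have p: "p \<in> X" "\<And>u. u \<in> X \<Longrightarrow> p \<le> u"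
      using assms by (auto simp: p_def)
    have eq: "delta u v = delta v p" if "u \<in> X" "v \<in> X" "u < v" for u v
    proof (cases "u = p")
      case False
      then show ?thesis
        using delta_max[of p u v] p that ascendingD[OF 2, of p u v]
        by (metis insert_subset empty_subsetI le_neq_implies_less less_imp_le max.absorb2
            delta_commute)
    qed (simp add: delta_commute)
    have less: "delta u p < delta v p" if "u \<in> X" "v \<in> X" "u < v" "u \<noteq> p" for u v
      using ascendingD[OF 2, of p u v] p that eq[of u v]
      by (simp add: le_neq_implies_less delta_commute)
    show thesis
    proof (rule that[OF p(1)])
      show "inj_on (\<lambda>u. delta u p) (X - {p})"
        by (rule inj_onI) (metis Diff_iff insertI1 less less_irrefl linorder_neqE_nat)
      show "labels Y = (\<lambda>u. delta u p) ` (Y - {p})" if "Y \<subseteq> X" "p \<in> Y" for Y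
      proof
        show "labels Y \<subseteq> (\<lambda>u. delta u p) ` (Y - {p})"
        proof
          fix x assume "x \<in> labels Y"
          then obtain u v where "x = delta u v" "u \<in> Y" "v \<in> Y" "u < v"
            by (auto simp: labels_def)
          then show "x \<in> (\<lambda>u. delta u p) ` (Y - {p})"
            using eq[of u v] p(2)[of u] that by (intro image_eqI[of _ _ v]) auto
        qed
        show "(\<lambda>u. delta u p) ` (Y - {p}) \<subseteq> labels Y"
        proof
          fix x assume "x \<in> (\<lambda>u. delta u p) ` (Y - {p})"
          then obtain u where "u \<in> Y" "u \<noteq> p" "x = delta p u"
            by (auto simp: delta_commute)
          then show "x \<in> labels Y"
            using that p(2)[of u] by (force simp: labels_def le_neq_implies_less)
        qed
      qed
    qed
  qed
qed

lemma card_labels_comb: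
  assumes "finite X" "X \<noteq> {}" "comb X"
  shows "card X = Suc (card (labels X))"
proof -
  obtain p where p: "p \<in> X" "inj_on (\<lambda>u. delta u p) (X - {p})"
    "\<And>Y. Y \<subseteq> X \<Longrightarrow> p \<in> Y \<Longrightarrow> labels Y = (\<lambda>u. delta u p) ` (Y - {p})"
    using comb_pivot[OF assms] by blast
  then have "card (labels X) = card (X - {p})"
    by (simp add: card_image)
  then show ?thesis
    using p(1) assms(1) card_Suc_Diff1 by metis
qed

text \<open>The pivot together with the vertices whose label against it lies in \<open>e\<close>
  realises exactly \<open>e\<close>.\<close>

lemma comb_sublabels:
  assumes "finite X" "X \<noteq> {}" "comb X" "e \<subseteq> labels X"
  obtains Y where "Y \<subseteq> X" "labels Y = e" "card Y = Suc (card e)"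
proof -
  obtain p where p: "p \<in> X" "inj_on (\<lambda>u. delta u p) (X - {p})"
    "\<And>Y. Y \<subseteq> X \<Longrightarrow> p \<in> Y \<Longrightarrow> labels Y = (\<lambda>u. delta u p) ` (Y - {p})"
    using comb_pivot[OF assms(1-3)] by blast
  define Z where "Z = {u \<in> X - {p}. delta u p \<in> e}"
  have "e \<subseteq> (\<lambda>u. delta u p) ` (X - {p})"
    using assms(4) p by auto
  then have e: "(\<lambda>u. delta u p) ` Z = e"
    by (auto simp: Z_def)
  have sub: "insert p Z \<subseteq> X" and "p \<notin> Z"
    using p by (auto simp: Z_def)
  then have lab: "labels (insert p Z) = e"
    using p(3)[of "insert p Z"] e by simp
  have "comb (insert p Z)"
    using comb_subset[OF assms(3) sub] .
  then have "card (insert p Z) = Suc (card e)"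
    using card_labels_comb[of "insert p Z"] lab finite_subset[OF sub assms(1)] by simp
  then show thesis
    using that[of "insert p Z"] sub lab by blast
qed

section \<open>Monotone runs and alternations in the sequence of gaps\<close>

lemma descending_window:
  assumes f: "strict_mono_on {a..Suc b} f"
    and step: "\<And>i. a \<le> i \<Longrightarrow> i < b \<Longrightarrow> delta (f (Suc i)) (f (Suc (Suc i))) < delta (f i) (f (Suc i))"
  shows "descending (f ` {a..Suc b})"
proof -
  have mono: "f i < f j" if "a \<le> i" "i < j" "j \<le> Suc b" for i j
    using strict_mono_onD[OF f] that by auto
  have anti: "delta (f j) (f (Suc j)) < delta (f i) (f (Suc i))" if "a \<le> i" "i < j" "j \<le> b" for i j
    using that(2,3)
  proof (induction j)
    case 0
    then show ?case by simp
  next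
    case (Suc j)
    then show ?case
      using step[of j] that(1) by (cases "i = j") auto
  qed
  \<comment> \<open>The first gap of a decreasing run dominates, so by \<open>delta_max\<close> it
    is the label of the whole stretch.\<close>
  have eq: "delta (f i) (f j) = delta (f i) (f (Suc i))" if "a \<le> i" "i < j" "j \<le> Suc b" for i j
    using that(2,3)
  proof (induction j)
    case 0
    then show ?case by simp
  next
    case (Suc j)
    show ?case
    proof (cases "i = j")
      case False
      then have "i < j" "j \<le> b" using Suc by auto
      then show ?thesis
        using delta_max[of "f i" "f j" "f (Suc j)"] mono[of i j] mono[of j "Suc j"]
          Suc.IH anti[of i j] that(1) by simp
    qed simp
  qed
  show ?thesis
    unfolding descending_def
  proof clarify
    fix i j l assume *: "i \<in> {a..Suc b}" "j \<in> {a..Suc b}" "l \<in> {a..Suc b}" "f i < f j" "f j < f l"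
    then have "i < j" "j < l"
      using strict_mono_on_less[OF f] by blast+
    then show "delta (f j) (f l) < delta (f i) (f j)"
      using * eq[of i j] eq[of j l] anti[of i j] by simp
  qed
qed

lemma ascending_window:
  assumes f: "strict_mono_on {a..Suc b} f"
    and step: "\<And>i. a \<le> i \<Longrightarrow> i < b \<Longrightarrow> delta (f i) (f (Suc i)) < delta (f (Suc i)) (f (Suc (Suc i)))"
  shows "ascending (f ` {a..Suc b})"
proof -
  have mono: "f i < f j" if "a \<le> i" "i < j" "j \<le> Suc b" for i j
    using strict_mono_onD[OF f] that by auto
  have eq: "delta (f i) (f (Suc j)) = delta (f j) (f (Suc j))" if "a \<le> i" "i \<le> j" "j \<le> b" for i j
    using that(2,3)
  proof (induction j)
    case 0
    then show ?case by simp
  next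
    case (Suc j)
    show ?case
    proof (cases "i = Suc j")
      case False
      then have "i \<le> j" "j < b" using Suc by auto
      then show ?thesis
        using delta_max[of "f i" "f (Suc j)" "f (Suc (Suc j))"] mono[of i "Suc j"]
          mono[of "Suc j" "Suc (Suc j)"] Suc.IH step[of j] that(1) by simp
    qed simp
  qed
  have mon: "delta (f i) (f (Suc i)) < delta (f j) (f (Suc j))" if "a \<le> i" "i < j" "j \<le> b" for i j
    using that(2,3)
  proof (induction j)
    case (Suc j)
    then show ?case
      using step[of j] that(1) by (cases "i = j") auto
  qed simp
  show ?thesis
    unfolding ascending_def
  proof clarify
    fix i j l assume *: "i \<in> {a..Suc b}" "j \<in> {a..Suc b}" "l \<in> {a..Suc b}" "f i < f j" "f j < f l"
    then have ij: "i < j" "j < l"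
      using strict_mono_on_less[OF f] by blast+
    then obtain j' l' where "j = Suc j'" "l = Suc l'"
      by (metis less_nat_zero_code not0_implies_Suc)
    then show "delta (f i) (f j) < delta (f j) (f l)"
      using * ij eq[of i j'] eq[of j l'] mon[of j' l'] by simp
  qed
qed

text \<open>The first \<open>4 * n + 1\<close> gaps are covered by four consecutive windows. Without
  a long comb each window has a rise and a fall, so the gaps rise, fall, rise and fall; two peaks
  around a valley give the second case.\<close>

lemma comb_or_alternating:
  assumes "finite S" "4 * n + 2 \<le> card S"
  obtains A where "A \<subseteq> S" "comb A" "card A = n + 2"
  | w0 w1 w2 w3 w4 w5 where "{w0, w1, w2, w3, w4, w5} \<subseteq> S"
    "w0 < w1" "w1 < w2" "w2 < w3" "w3 < w4" "w4 < w5"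
    "delta w0 w1 < delta w1 w2" "delta w2 w3 < delta w1 w2"
    "delta w2 w3 < delta w3 w4" "delta w4 w5 < delta w3 w4"
proof -
  define f where "f i = sorted_list_of_set S ! i" for i
  define d where "d i = delta (f i) (f (Suc i))" for i
  have f_less: "f i < f j" if "i < j" "j \<le> 4 * n + 1" for i j
    using strict_sorted_list_of_set[of S] that assms(2)
    by (auto simp: f_def intro: sorted_wrt_nth_less)
  have f_mem: "f i \<in> S" if "i \<le> 4 * n + 1" for i
    using that assms nth_mem[of i "sorted_list_of_set S"] by (simp add: f_def)
  have mono: "strict_mono_on {a..b} f" if "b \<le> 4 * n + 1" for a b
    using f_less that by (auto intro!: strict_mono_onI)
  have d_neq: "d i \<noteq> d (Suc i)" if "i < 4 * n" for i
    using delta_neq[of "f i" "f (Suc i)" "f (Suc (Suc i))"] f_less that by (simp add: d_def)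
  have card_window: "card (f ` {a..Suc (a + n)}) = n + 2" "f ` {a..Suc (a + n)} \<subseteq> S"
    if "a + n \<le> 4 * n" for a
  proof -
    have "inj_on f {a..Suc (a + n)}"
      using mono[of "Suc (a + n)" a] that by (simp add: strict_mono_on_imp_inj_on)
    then show "card (f ` {a..Suc (a + n)}) = n + 2"
      by (simp add: card_image)
    show "f ` {a..Suc (a + n)} \<subseteq> S"
      using f_mem that by auto
  qed
  show thesis
  proof (cases "\<exists>A. A \<subseteq> S \<and> comb A \<and> card A = n + 2")
    case True
    then show ?thesis using that(1) by blast
  next
    case False
    \<comment> \<open>A window of \<open>n + 2\<close> vertices whose gaps never rise is a comb,
      since neighbouring gaps differ.\<close>
    have up: "\<exists>i\<ge>a. i < a + n \<and> d i < d (Suc i)" if "a + n \<le> 4 * n" for a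
    proof (rule ccontr)
      assume no: "\<not> ?thesis"
      have "descending (f ` {a..Suc (a + n)})"
      proof (rule descending_window)
        show "strict_mono_on {a..Suc (a + n)} f" using mono that by simp
        show "delta (f (Suc i)) (f (Suc (Suc i))) < delta (f i) (f (Suc i))"
          if "a \<le> i" "i < a + n" for i
          using no that d_neq[of i] \<open>a + n \<le> 4 * n\<close>
          by (metis d_def linorder_neqE_nat order.strict_trans2)
      qed
      then show False
        using False card_window[OF that] by (auto simp: comb_def)
    qed
    have down: "\<exists>i\<ge>a. i < a + n \<and> d (Suc i) < d i" if "a + n \<le> 4 * n" for a
    proof (rule ccontr)
      assume no: "\<not> ?thesis"
      have "ascending (f ` {a..Suc (a + n)})"
      proof (rule ascending_window)
        show "strict_mono_on {a..Suc (a + n)} f" using mono that by simp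
        show "delta (f i) (f (Suc i)) < delta (f (Suc i)) (f (Suc (Suc i)))"
          if "a \<le> i" "i < a + n" for i
          using no that d_neq[of i] \<open>a + n \<le> 4 * n\<close>
          by (metis d_def linorder_neqE_nat order.strict_trans2)
      qed
      then show False
        using False card_window[OF that] by (auto simp: comb_def)
    qed
    obtain t1 t2 t3 t4 where
      t1: "t1 < n" "d t1 < d (Suc t1)" and
      t2: "n \<le> t2" "t2 < 2 * n" "d (Suc t2) < d t2" and
      t3: "2 * n \<le> t3" "t3 < 3 * n" "d t3 < d (Suc t3)" and
      t4: "3 * n \<le> t4" "t4 < 4 * n" "d (Suc t4) < d t4"
      using up[of 0] down[of n] up[of "2 * n"] down[of "3 * n"] by auto
    \<comment> \<open>Each of \<open>p\<close>, \<open>q\<close>, \<open>r\<close> is the first turn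
      after the previous one: \<open>p\<close> and \<open>r\<close> are peaks of \<open>d\<close>,
      and \<open>q\<close> is the valley between them.\<close>
    define p where "p = (LEAST i. t1 \<le> i \<and> d (Suc i) < d i)"
    define q where "q = (LEAST i. p \<le> i \<and> d i < d (Suc i))"
    define r where "r = (LEAST i. q \<le> i \<and> d (Suc i) < d i)"
    have p: "t1 \<le> p" "d (Suc p) < d p"
      using LeastI[of "\<lambda>i. t1 \<le> i \<and> d (Suc i) < d i" t2] t1 t2 by (auto simp: p_def)
    have "p \<le> t2"
      unfolding p_def using t1 t2 by (intro Least_le) auto
    then have q: "p \<le> q" "d q < d (Suc q)"
      using LeastI[of "\<lambda>i. p \<le> i \<and> d i < d (Suc i)" t3] t2 t3 by (auto simp: q_def)
    have "q \<le> t3"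
      unfolding q_def using \<open>p \<le> t2\<close> t2 t3 by (intro Least_le) auto
    then have r: "q \<le> r" "d (Suc r) < d r"
      using LeastI[of "\<lambda>i. q \<le> i \<and> d (Suc i) < d i" t4] t3 t4 by (auto simp: r_def)
    have "r \<le> t4"
      unfolding r_def using \<open>q \<le> t3\<close> t3 t4 by (intro Least_le) auto
    have "t1 < p" "p < q" "q < r"
      using p q r t1 by (metis le_neq_implies_less less_asym)+
    then obtain p' where p': "p = Suc p'" "t1 \<le> p'"
      by (cases p) auto
    have "\<not> d (Suc p') < d p'"
      using not_less_Least[of p' "\<lambda>i. t1 \<le> i \<and> d (Suc i) < d i"] p' by (auto simp flip: p_def)
    then have p'_up: "d p' < d p"
      using d_neq[of p'] p' \<open>p \<le> t2\<close> t2 by auto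
    have pq: "d (Suc i) < d i" if "p \<le> i" "i < q" for i
    proof -
      have "\<not> d i < d (Suc i)"
        using not_less_Least[of i "\<lambda>i. p \<le> i \<and> d i < d (Suc i)"] that by (auto simp flip: q_def)
      then show ?thesis
        using d_neq[of i] that \<open>q \<le> t3\<close> t3 by auto
    qed
    have qr: "d i < d (Suc i)" if "q \<le> i" "i < r" for i
    proof -
      have "\<not> d (Suc i) < d i"
        using not_less_Least[of i "\<lambda>i. q \<le> i \<and> d (Suc i) < d i"] that by (auto simp flip: r_def)
      then show ?thesis
        using d_neq[of i] that \<open>r \<le> t4\<close> t4 by auto
    qed
    have r_le: "Suc (Suc r) \<le> 4 * n + 1"
      using \<open>r \<le> t4\<close> t4 by simp
    note order = \<open>p < q\<close> \<open>q < r\<close> r_le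
    have desc: "descending (f ` {p..Suc q})"
      using pq order by (intro descending_window mono) (auto simp: d_def)
    have asc: "ascending (f ` {q..Suc r})"
      using qr order by (intro ascending_window mono) (auto simp: d_def)
    have lt: "f p' < f p" "f p < f q" "f q < f (Suc q)" "f (Suc q) < f (Suc r)"
      "f (Suc r) < f (Suc (Suc r))" "f p < f (Suc p)" "f r < f (Suc r)"
      using order p' by (auto intro!: f_less)
    have le: "f (Suc p) \<le> f q" "f (Suc q) \<le> f r"
      using order f_less[of "Suc p" q] f_less[of "Suc q" r]
      by (auto simp: le_less dest: Suc_lessI intro!: f_less)
    show ?thesis
    \<comment> \<open>By monotonicity the stretch from \<open>p\<close> to \<open>q\<close> has
      label \<open>d p\<close>, and the one from \<open>Suc q\<close> to \<open>Suc r\<close> has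
      label \<open>d r\<close>.\<close>
    proof (rule that(2))
      show "{f p', f p, f q, f (Suc q), f (Suc r), f (Suc (Suc r))} \<subseteq> S"
        using f_mem order p' by auto
      show "delta (f q) (f (Suc q)) < delta (f p) (f q)"
        using lt order by (intro descendingD[OF desc]) auto
      show "delta (f q) (f (Suc q)) < delta (f (Suc q)) (f (Suc r))"
        using lt order by (intro ascendingD[OF asc]) auto
      show "delta (f p') (f p) < delta (f p) (f q)"
        using delta_max[of "f p" "f (Suc p)" "f q"] lt le p'_up p' by (simp add: d_def)
      show "delta (f (Suc r)) (f (Suc (Suc r))) < delta (f (Suc q)) (f (Suc r))"
        using delta_max[of "f (Suc q)" "f r" "f (Suc r)"] lt le r by (simp add: d_def)
    qed (use lt in auto)
  qed
qed

section \<open>Stepping up the uniformity\<close>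

text \<open>A witness that \<open>N\<close> vertices do not suffice. Its vertices are an initial
  segment so that they can serve as the labels of numbers below \<open>2 ^ N\<close>.\<close>

definition avoids :: "nat \<Rightarrow> nat \<Rightarrow> nat \<Rightarrow> nat \<Rightarrow> bool" where
  "avoids k s n N \<longleftrightarrow> (\<exists>E \<subseteq> [{..<N}]\<^bsup>k\<^esup>.
     (\<forall>S \<subseteq> {..<N}. card S = s \<longrightarrow> \<not> [S]\<^bsup>k\<^esup> \<subseteq> E) \<and>
     (\<forall>I \<subseteq> {..<N}. card I = n \<longrightarrow> (\<exists>e\<in>E. e \<subseteq> I)))"

text \<open>Only the first five entries count, so five vertices with this pattern can be filled up
  by larger ones to any higher uniformity.\<close>

definition zigzag :: "nat list \<Rightarrow> bool" where
  "zigzag xs \<longleftrightarrow> delta (xs ! 0) (xs ! 1) < delta (xs ! 1) (xs ! 2) \<and>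
     delta (xs ! 2) (xs ! 3) < delta (xs ! 1) (xs ! 2) \<and>
     delta (xs ! 2) (xs ! 3) < delta (xs ! 3) (xs ! 4)"

lemma not_comb_zigzag:
  assumes "comb (set xs)" "sorted_wrt (<) xs" "5 \<le> length xs"
  shows "\<not> zigzag xs"
proof
  assume z: "zigzag xs"
  have less: "xs ! i < xs ! j" if "i < j" "j < 5" for i j
    using sorted_wrt_nth_less[OF assms(2)] that assms(3) by simp
  have nth: "xs ! i \<in> set xs" if "i < 5" for i
    using that assms(3) by (intro nth_mem) simp
  have mem: "{xs ! 0, xs ! 1, xs ! 2, xs ! 3} \<subseteq> set xs"
    by (simp add: nth)
  consider "descending (set xs)" | "ascending (set xs)"
    using assms(1) by (auto simp: comb_def)
  then show False
  proof cases
    case 1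
    then show False
      using descendingD[OF 1, of "xs ! 0" "xs ! 1" "xs ! 2"] less[of 0 1] less[of 1 2] mem z
      by (simp add: zigzag_def)
  next
    case 2
    then show False
      using ascendingD[OF 2, of "xs ! 1" "xs ! 2" "xs ! 3"] less[of 1 2] less[of 2 3] mem z
      by (simp add: zigzag_def)
  qed
qed

text \<open>A zigzag in \<open>butlast xs\<close> gives \<open>d 1 > d 2 < d 3\<close>, so
  \<open>tl xs\<close> is neither a comb nor a zigzag. A zigzag in \<open>tl xs\<close> gives
  \<open>d 1 < d 2 > d 3\<close>, and length six puts these gaps inside \<open>butlast xs\<close>,
  which then is no comb. So both parts are combs, and the shared gaps \<open>d 1\<close>,
  \<open>d 2\<close> force the same direction.\<close>

lemma comb_if_butlast_tl:
  assumes xs: "sorted_wrt (<) xs" "6 \<le> length xs"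
    and bl: "comb (set (butlast xs)) \<or> zigzag (butlast xs)"
    and tl: "comb (set (tl xs)) \<or> zigzag (tl xs)"
  shows "comb (set xs)"
proof -
  define d where "d i = delta (xs ! i) (xs ! Suc i)" for i
  obtain l where l: "length xs = Suc (Suc (Suc l))" "3 \<le> l"
    using that[of "length xs - 3"] xs(2) by auto
  have less: "xs ! i < xs ! j" if "i < j" "j < length xs" for i j
    using sorted_wrt_nth_less[OF xs(1)] that by simp
  have mem: "xs ! i \<in> set (butlast xs)" if "i < Suc (Suc l)" for i
    using that l nth_butlast[of i xs] nth_mem[of i "butlast xs"] by simp
  have mem': "xs ! Suc i \<in> set (tl xs)" if "i < Suc (Suc l)" for i
    using that l nth_tl[of i xs] nth_mem[of i "tl xs"] by simp
  have zb: "zigzag (butlast xs) \<longleftrightarrow> d 0 < d 1 \<and> d 2 < d 1 \<and> d 2 < d 3"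
    using l by (simp add: zigzag_def d_def nth_butlast eval_nat_numeral)
  have zt: "zigzag (tl xs) \<longleftrightarrow> d 1 < d 2 \<and> d 3 < d 2 \<and> d 3 < d 4"
    using l by (simp add: zigzag_def d_def nth_tl eval_nat_numeral)
  have db: "d (Suc i) < d i" if "descending (set (butlast xs))" "i < l" for i
    unfolding d_def using that l by (intro descendingD[OF that(1)]) (auto intro!: mem less)
  have ab: "d i < d (Suc i)" if "ascending (set (butlast xs))" "i < l" for i
    unfolding d_def using that l by (intro ascendingD[OF that(1)]) (auto intro!: mem less)
  have dt: "d (Suc (Suc i)) < d (Suc i)" if "descending (set (tl xs))" "i < l" for i
    unfolding d_def using that l by (intro descendingD[OF that(1)]) (auto intro!: mem' less)
  have at: "d (Suc i) < d (Suc (Suc i))" if "ascending (set (tl xs))" "i < l" for i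
    unfolding d_def using that l by (intro ascendingD[OF that(1)]) (auto intro!: mem' less)
  have nb: "\<not> zigzag (butlast xs)"
    using tl zb zt dt[of 0] dt[of 1] at[of 0] l(2) by (auto simp: comb_def eval_nat_numeral)
  have nt: "\<not> zigzag (tl xs)"
    using bl nb zt db[of 1] ab[of 2] l(2) by (auto simp: comb_def eval_nat_numeral)
  have image: "set xs = (!) xs ` {0..Suc (Suc l)}"
    using l by (auto simp: set_conv_nth image_iff)
  have sm: "strict_mono_on {0..Suc (Suc l)} ((!) xs)"
    using less l by (auto intro!: strict_mono_onI)
  consider "descending (set (butlast xs))" "descending (set (tl xs))"
    | "ascending (set (butlast xs))" "ascending (set (tl xs))"
    using bl tl nb nt db[of 1] ab[of 1] dt[of 0] at[of 0] l(2) by (force simp: comb_def)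
  then show ?thesis
  proof cases
    case 1
    have "d (Suc i) < d i" if "i < Suc l" for i
      using that db[OF 1(1), of i] dt[OF 1(2), of "i - 1"] l(2) by (cases i) auto
    then have "descending (set xs)"
      unfolding image using sm by (intro descending_window) (auto simp: d_def)
    then show ?thesis by (simp add: comb_def)
  next
    case 2
    have "d i < d (Suc i)" if "i < Suc l" for i
      using that ab[OF 2(1), of i] at[OF 2(2), of "i - 1"] l(2) by (cases i) auto
    then have "ascending (set xs)"
      unfolding image using sm by (intro ascending_window) (auto simp: d_def)
    then show ?thesis by (simp add: comb_def)
  qed
qed

text \<open>One triple refutes \<open>descending\<close> and one refutes \<open>ascending\<close>;
  together they span at most six vertices.\<close>

lemma comb_if_small_subsets:
  assumes fin: "finite S" "6 \<le> m" "m \<le> card S"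
    and sub: "\<And>U. U \<subseteq> S \<Longrightarrow> card U = m \<Longrightarrow> comb U"
  shows "comb S"
proof (rule ccontr)
  assume "\<not> comb S"
  then obtain u v w u' v' w' where
    1: "{u, v, w} \<subseteq> S" "u < v" "v < w" "\<not> delta v w < delta u v" and
    2: "{u', v', w'} \<subseteq> S" "u' < v'" "v' < w'" "\<not> delta u' v' < delta v' w'"
    unfolding comb_def descending_def ascending_def by blast
  have "card (set [u, v, w, u', v', w']) \<le> m"
    using card_length[of "[u, v, w, u', v', w']"] fin(2) by simp
  moreover have "set [u, v, w, u', v', w'] \<subseteq> S"
    using 1 2 by simp
  ultimately obtain U where "set [u, v, w, u', v', w'] \<subseteq> U" "U \<subseteq> S" "card U = m"
    using exists_subset_between[of "set [u, v, w, u', v', w']" m S] fin by blast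
  then show False
    using sub[of U] 1 2 descendingD[of U u v w] ascendingD[of U u' v' w'] by (auto simp: comb_def)
qed

text \<open>The lowest \<open>4 * n + 2\<close> vertices of a candidate independent set supply a
  comb or an alternation; the top \<open>k\<close> are a reserve for filling an alternation up to an
  edge.\<close>

lemma avoids_Suc:
  assumes "avoids k s n N" "4 \<le> k" "k < s"
  shows "avoids (Suc k) (Suc s) (4 * n + 2 + k) (2 ^ N)"
proof -
  obtain E where E: "E \<subseteq> [{..<N}]\<^bsup>k\<^esup>"
    and clique: "\<And>S. S \<subseteq> {..<N} \<Longrightarrow> card S = s \<Longrightarrow> \<not> [S]\<^bsup>k\<^esup> \<subseteq> E"
    and indep: "\<And>I. I \<subseteq> {..<N} \<Longrightarrow> card I = n \<Longrightarrow> \<exists>e\<in>E. e \<subseteq> I"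
    using assms(1) unfolding avoids_def by blast
  define F where "F = {X \<in> [{..<2 ^ N}]\<^bsup>Suc k\<^esup>.
    comb X \<and> labels X \<in> E \<or> zigzag (sorted_list_of_set X)}"
  have no_clique: "\<not> [S]\<^bsup>Suc k\<^esup> \<subseteq> F" if S: "S \<subseteq> {..<2 ^ N}" "card S = Suc s" for S
  proof
    assume sub: "[S]\<^bsup>Suc k\<^esup> \<subseteq> F"
    have finS: "finite S" using S finite_subset by blast
    have edge: "X \<in> F" if "X \<subseteq> S" "card X = Suc k" for X
      using sub that finite_subset[OF _ finS] by (auto simp: nsets_def)
    have "comb S"
    \<comment> \<open>With \<open>k + 2\<close> vertices, \<open>butlast\<close> and
      \<open>tl\<close> have edge size \<open>Suc k\<close>; \<open>k < s\<close> ensures that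
      \<open>S\<close> is that large.\<close>
    proof (rule comb_if_small_subsets[OF finS, of "k + 2"])
      fix U assume U: "U \<subseteq> S" "card U = k + 2"
      define xs where "xs = sorted_list_of_set U"
      have finU: "finite U" using U finS finite_subset by blast
      have xs: "sorted_wrt (<) xs" "length xs = k + 2" "set xs = U"
        using finU U by (auto simp: xs_def)
      have good: "comb (set ys) \<or> zigzag ys"
        if "sorted_wrt (<) ys" "set ys \<subseteq> S" "length ys = Suc k" for ys
      proof -
        have "sorted_list_of_set (set ys) = ys"
          using that(1) by (simp add: strict_sorted_iff sorted_list_of_set.idem_if_sorted_distinct)
        moreover have "card (set ys) = Suc k"
          using that by (simp add: strict_sorted_iff distinct_card)
        ultimately show ?thesis
          using edge[of "set ys"] that(2) by (auto simp: F_def)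
      qed
      have "sorted_wrt (<) (butlast xs)" "sorted_wrt (<) (tl xs)"
        using xs(1) sorted_wrt_take[of "(<)" xs "length xs - 1"] sorted_wrt_drop[of "(<)" xs 1]
        by (simp_all add: butlast_conv_take drop_Suc)
      moreover have "set (butlast xs) \<subseteq> S" "set (tl xs) \<subseteq> S"
        using xs(3) U(1) in_set_butlastD[of _ xs] list.set_sel(2)[of xs]
        by (auto, metis list.sel(2) list.set_sel(2) subsetD)
      ultimately show "comb U"
        using comb_if_butlast_tl[of xs] xs good[of "butlast xs"] good[of "tl xs"] assms(2) by simp
    qed (use assms S in auto)
    moreover have "S \<noteq> {}" using S by auto
    ultimately have "card (labels S) = s"
      using card_labels_comb[OF finS] S(2) by simp
    \<comment> \<open>A \<open>k\<close>-set of labels outside \<open>E\<close> lifts to a subset of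
      the comb, which is no zigzag either and hence a non-edge.\<close>
    then obtain e where e: "e \<in> [labels S]\<^bsup>k\<^esup>" "e \<notin> E"
      using clique[OF labels_subset[OF S(1)]] by blast
    then obtain Y where Y: "Y \<subseteq> S" "labels Y = e" "card Y = Suc k"
      using comb_sublabels[OF finS \<open>S \<noteq> {}\<close> \<open>comb S\<close>, of e] by (auto simp: nsets_def)
    have "comb Y" using comb_subset \<open>comb S\<close> Y(1) .
    then have "\<not> zigzag (sorted_list_of_set Y)"
      using not_comb_zigzag[of "sorted_list_of_set Y"] Y finite_subset[OF Y(1) finS] assms(2) by simp
    then show False
      using edge[of Y] Y e by (simp add: F_def)
  qed
  have no_indep: "\<exists>e\<in>F. e \<subseteq> I" if I: "I \<subseteq> {..<2 ^ N}" "card I = 4 * n + 2 + k" for I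
  proof -
    define xs where "xs = sorted_list_of_set I"
    have finI: "finite I" using I finite_subset by blast
    have xs: "sorted_wrt (<) xs" "length xs = 4 * n + 2 + k" "set xs = I" "distinct xs"
      using finI I by (auto simp: xs_def)
    define J where "J = set (take (4 * n + 2) xs)"
    have J: "J \<subseteq> I" "finite J" "card J = 4 * n + 2"
      using xs by (auto simp: J_def distinct_card dest: in_set_takeD)
    show ?thesis
    proof (rule comb_or_alternating[of J n])
      show "finite J" "4 * n + 2 \<le> card J" using J by auto
    next
      fix A assume A: "A \<subseteq> J" "comb A" "card A = n + 2"
      then have ne: "A \<noteq> {}" and finA: "finite A"
        using J finite_subset by auto
      have "card (labels A) = Suc n"
        using card_labels_comb[OF finA ne A(2)] A(3) by simp
      \<comment> \<open>A comb on \<open>n + 2\<close> vertices has \<open>n + 1\<close> labels; one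
        is dropped.\<close>
      then obtain L where L: "L \<subseteq> labels A" "card L = n"
        by (metis Suc_n_not_le_n nat_le_linear obtain_subset_with_card_n)
      have "labels A \<subseteq> {..<N}"
        using A J I by (intro labels_subset) auto
      then obtain e where e: "e \<in> E" "e \<subseteq> L"
        using indep[of L] L by blast
      then obtain Y where Y: "Y \<subseteq> A" "labels Y = e" "card Y = Suc (card e)"
        using comb_sublabels[OF finA ne A(2), of e] L by blast
      have "card e = k" using e E by (auto simp: nsets_def)
      then have "Y \<in> F"
        using Y A J I e comb_subset[OF A(2) Y(1)] finite_subset[OF Y(1) finA]
        by (auto simp: F_def nsets_def)
      then show ?thesis
        using Y A J by blast
    next
      fix w0 w1 w2 w3 w4 w5
      assume w: "{w0, w1, w2, w3, w4, w5} \<subseteq> J"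
        "w0 < w1" "w1 < w2" "w2 < w3" "w3 < w4" "w4 < w5"
        "delta w0 w1 < delta w1 w2" "delta w2 w3 < delta w1 w2"
        "delta w2 w3 < delta w3 w4" "delta w4 w5 < delta w3 w4"
      \<comment> \<open>\<open>w5\<close> is left out, and \<open>k - 4\<close> reserve vertices
        above \<open>J\<close> bring the size to \<open>k + 1\<close>.\<close>
      define zs where "zs = [w0, w1, w2, w3, w4] @ take (k - 4) (drop (4 * n + 2) xs)"
      have above: "x < y" if "x \<in> J" "y \<in> set (drop (4 * n + 2) xs)" for x y
        using xs(1) that by (metis J_def append_take_drop_id sorted_wrt_append)
      have "sorted_wrt (<) zs"
        using w xs(1) above
        by (auto simp: zs_def sorted_wrt_append intro!: sorted_wrt_take sorted_wrt_drop
            dest!: in_set_takeD)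
      then have sl: "sorted_list_of_set (set zs) = zs" and "distinct zs"
        by (simp_all add: strict_sorted_iff sorted_list_of_set.idem_if_sorted_distinct)
      then have "card (set zs) = Suc k"
        using xs(2) assms(2) by (simp add: distinct_card) (simp add: zs_def)
      moreover have "set zs \<subseteq> I"
        using w(1) J(1) xs(3) by (auto simp: zs_def dest!: in_set_takeD in_set_dropD)
      moreover have "zigzag zs"
        using w by (simp add: zigzag_def zs_def)
      ultimately have "set zs \<in> F"
        using I sl by (auto simp: F_def nsets_def)
      then show ?thesis
        using \<open>set zs \<subseteq> I\<close> by blast
    qed
  qed
  show ?thesis
    unfolding avoids_def
    by (rule exI[of _ F]) (use no_clique no_indep in \<open>auto simp: F_def\<close>)
qed

section \<open>The double exponential construction for uniformity four\<close>

definition triad :: "(nat \<Rightarrow> nat \<Rightarrow> bool) \<Rightarrow> nat \<Rightarrow> nat \<Rightarrow> nat \<Rightarrow> bool" where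
  "triad \<phi> x y z \<longleftrightarrow> \<not> \<phi> x y \<and> \<phi> x z \<and> \<not> \<phi> y z"

text \<open>Disjoint blocks give independent events, each leaving 7 of the 8 patterns on its three
  elements; the probability bound is written without division.\<close>

lemma card_avoiding_le:
  assumes "finite I" "disjoint_family_on D I" "finite P"
    and "\<And>i. i \<in> I \<Longrightarrow> D i \<subseteq> P \<and> card (D i) = 3 \<and> T i \<subseteq> D i"
  shows "card {G \<in> Pow P. \<forall>i\<in>I. G \<inter> D i \<noteq> T i} * 8 ^ card I \<le> 7 ^ card I * 2 ^ card P"
  using assms
proof (induction I arbitrary: P rule: finite_induct)
  case empty
  then show ?case by (simp add: card_Pow del: Pow_iff)
next
  case (insert i I)
  define Q where "Q = P - D i"
  define U where "U = {G \<in> Pow Q. \<forall>i\<in>I. G \<inter> D i \<noteq> T i}"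
  define V where "V = {G \<in> Pow P. \<forall>l\<in>insert i I. G \<inter> D l \<noteq> T l}"
  have i: "D i \<subseteq> P" "card (D i) = 3" "T i \<subseteq> D i"
    using insert.prems(3) by auto
  have finD: "finite (D i)" using i insert.prems(2) finite_subset by blast
  have disj: "D l \<inter> D i = {}" if "l \<in> I" for l
    using insert.prems(1) insert.hyps(2) that by (auto simp: disjoint_family_on_def)
  have Q: "finite Q" "D l \<subseteq> Q" if "l \<in> I" for l
    using insert.prems disj[OF that] that by (auto simp: Q_def)
  have finQ: "finite Q" using insert.prems(2) by (simp add: Q_def)
  have IH: "card U * 8 ^ card I \<le> 7 ^ card I * 2 ^ card Q"
    unfolding U_def
  proof (rule insert.IH)
    show "disjoint_family_on D I"
      using insert.prems(1) by (auto simp: disjoint_family_on_def)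
    show "D l \<subseteq> Q \<and> card (D l) = 3 \<and> T l \<subseteq> D l" if "l \<in> I" for l
      using insert.prems(3) Q that by auto
  qed (rule finQ)
  \<comment> \<open>A set is determined by its traces on \<open>D i\<close> and \<open>Q\<close>;
    the first has 7 admissible values.\<close>
  have "card V \<le> card ((Pow (D i) - {T i}) \<times> U)"
  proof (rule card_inj_on_le)
    show "inj_on (\<lambda>G. (G \<inter> D i, G \<inter> Q)) V"
    proof (rule inj_onI)
      fix G H assume "G \<in> V" "H \<in> V" and "(G \<inter> D i, G \<inter> Q) = (H \<inter> D i, H \<inter> Q)"
      then show "G = H" by (auto simp: V_def Q_def)
    qed
    have "G \<inter> Q \<inter> D l = G \<inter> D l" if "l \<in> I" for G l
      using Q[OF that] by auto
    then show "(\<lambda>G. (G \<inter> D i, G \<inter> Q)) ` V \<subseteq> (Pow (D i) - {T i}) \<times> U"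
      by (auto simp: V_def U_def)
    show "finite ((Pow (D i) - {T i}) \<times> U)"
      using finD finQ by (simp add: U_def)
  qed
  also have "\<dots> = 7 * card U"
    using i finD by (simp add: card_cartesian_product card_Diff_subset card_Pow del: Pow_iff)
      (simp add: card_Diff_singleton card_Pow)
  finally have "card V * 8 ^ card (insert i I) \<le> 7 * card U * 8 ^ card (insert i I)"
    by (rule mult_le_mono1)
  also have "\<dots> = 7 * 8 * (card U * 8 ^ card I)"
    using insert.hyps by simp
  also have "\<dots> \<le> 7 * 8 * (7 ^ card I * 2 ^ card Q)"
    using IH by simp
  also have "\<dots> = 7 ^ card (insert i I) * 2 ^ (card Q + card (D i))"
    using insert.hyps i by (simp add: power_add)
  also have "card Q + card (D i) = card P"
    using i(1) card_mono[OF insert.prems(2) i(1)] finD by (simp add: Q_def card_Diff_subset)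
  finally show ?case by (simp add: V_def)
qed

text \<open>The pairs of the triples \<open>(z\<^sub>a, y\<^sub>b, x\<^sub>c)\<close> with \<open>c = (a + b) mod t\<close> from three consecutive
  blocks of length \<open>t\<close> are distinct, which gives \<open>t\<^sup>2\<close> independent events.\<close>

lemma card_triad_free_le:
  fixes S :: "nat set"
  assumes "S \<subseteq> {..<M}" "card S = 3 * t"
  shows "card {G \<in> Pow ({..<M} \<times> {..<M}). \<not> (\<exists>x\<in>S. \<exists>y\<in>S. \<exists>z\<in>S. z < y \<and> y < x \<and>
      triad (\<lambda>u v. (u, v) \<in> G) x y z)} * 8 ^ (t * t) \<le> 7 ^ (t * t) * 2 ^ (M * M)"
    (is "card ?B * _ \<le> _")
proof -
  define f where "f i = sorted_list_of_set S ! i" for i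
  have finS: "finite S" using assms(1) finite_subset by blast
  have f_less: "f i < f j" if "i < j" "j < 3 * t" for i j
    using strict_sorted_list_of_set[of S] that assms(2)
    by (auto simp: f_def intro: sorted_wrt_nth_less)
  have f_mem: "f i \<in> S" if "i < 3 * t" for i
    using that assms finS nth_mem[of i "sorted_list_of_set S"] by (simp add: f_def)
  have f_eq: "f i = f j \<longleftrightarrow> i = j" if "i < 3 * t" "j < 3 * t" for i j
    using f_less[of i j] f_less[of j i] that by (metis less_irrefl linorder_neqE_nat)
  define z where "z = (\<lambda>(a::nat, b::nat). f a)"
  define y where "y = (\<lambda>(a::nat, b). f (t + b))"
  define x where "x = (\<lambda>(a, b). f (2 * t + (a + b) mod t))"
  define D where "D i = {(x i, y i), (x i, z i), (y i, z i)}" for i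
  define T where "T i = {(x i, z i)}" for i
  let ?I = "{..<t} \<times> {..<t}"
  have ord: "z i < y i" "y i < x i" "x i \<in> S" "y i \<in> S" "z i \<in> S" if "i \<in> ?I" for i
  proof -
    obtain a b where i: "i = (a, b)" "a < t" "b < t" using \<open>i \<in> ?I\<close> by auto
    then have "(a + b) mod t < t" by simp
    then show "z i < y i" "y i < x i" "x i \<in> S" "y i \<in> S" "z i \<in> S"
      using i by (auto simp: x_def y_def z_def intro!: f_less f_mem)
  qed
  have disj: "disjoint_family_on D ?I"
    unfolding disjoint_family_on_def
  proof (intro ballI impI)
    fix i i' assume i: "i \<in> ?I" "i' \<in> ?I" "i \<noteq> i'"
    obtain a b where ab: "i = (a, b)" "a < t" "b < t" using i by auto
    obtain a' b' where ab': "i' = (a', b')" "a' < t" "b' < t" using i by auto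
    define c where "c = (a + b) mod t"
    define c' where "c' = (a' + b') mod t"
    have c: "c < t" "c' < t" using ab by (auto simp: c_def c'_def)
    \<comment> \<open>Any two of \<open>a\<close>, \<open>b\<close>, \<open>c\<close> determine the
      third, so distinct triples share at most one vertex and thus no pair.\<close>
    have ac: "b = b'" if "a = a'" "c = c'"
    proof -
      have "[a + b = a + b'] (mod t)"
        using that by (simp add: c_def c'_def cong_def)
      then show ?thesis
        using ab ab' by (simp add: cong_add_lcancel_nat cong_less_modulus_unique_nat)
    qed
    have bc: "a = a'" if "b = b'" "c = c'"
    proof -
      have "[a + b = a' + b] (mod t)"
        using that by (simp add: c_def c'_def cong_def)
      then show ?thesis
        using ab ab' by (simp add: cong_add_rcancel_nat cong_less_modulus_unique_nat)
    qed
    have "x i = x i' \<longleftrightarrow> c = c'" "y i = y i' \<longleftrightarrow> b = b'" "z i = z i' \<longleftrightarrow> a = a'"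
      "x i \<noteq> y i'" "y i \<noteq> x i'" "y i \<noteq> z i'" "z i \<noteq> y i'"
      using ab ab' c unfolding ab(1) ab'(1) x_def y_def z_def
      by (simp_all add: f_eq flip: c_def c'_def)
    moreover have ne: "\<not> (a = a' \<and> b = b')"
      using i(3) ab(1) ab'(1) by simp
    moreover have "\<not> (a = a' \<and> c = c')"
      using ne ac by blast
    moreover have "\<not> (b = b' \<and> c = c')"
      using ne bc by blast
    ultimately have "u \<notin> D i'" if "u \<in> D i" for u
      using that unfolding D_def by (elim insertE emptyE) (simp_all, blast+)
    then show "D i \<inter> D i' = {}"
      by blast
  qed
  have sub: "D i \<subseteq> {..<M} \<times> {..<M} \<and> card (D i) = 3 \<and> T i \<subseteq> D i" if "i \<in> ?I" for i
    using ord[OF that] assms(1) by (auto simp: D_def T_def)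
  have "?B \<subseteq> {G \<in> Pow ({..<M} \<times> {..<M}). \<forall>i\<in>?I. G \<inter> D i \<noteq> T i}" (is "_ \<subseteq> ?A")
  proof
    fix G assume G: "G \<in> ?B"
    have "G \<inter> D i \<noteq> T i" if i: "i \<in> ?I" for i
    proof
      assume eq: "G \<inter> D i = T i"
      have "(x i, y i) \<notin> T i" "(y i, z i) \<notin> T i"
        using ord[OF i] by (auto simp: T_def)
      then have "(x i, y i) \<notin> G" "(x i, z i) \<in> G" "(y i, z i) \<notin> G"
        using eq by (auto simp: D_def T_def)
      then have "triad (\<lambda>u v. (u, v) \<in> G) (x i) (y i) (z i)"
        by (simp add: triad_def)
      then show False using G ord[OF i] by blast
    qed
    then show "G \<in> ?A" using G by blast
  qed
  then have "card ?B \<le> card ?A" by (intro card_mono) auto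
  moreover have "card ?A * 8 ^ card ?I \<le> 7 ^ card ?I * 2 ^ card ({..<M} \<times> {..<M})"
    using disj sub by (intro card_avoiding_le) auto
  ultimately show ?thesis
    by (simp add: card_cartesian_product) (meson le_trans mult_le_mono1)
qed

text \<open>Union bound over the at most \<open>M ^ (3 * t)\<close> sets of size
  \<open>3 * t\<close>, each spoiling at most a fraction \<open>(7 / 8) ^ (t * t)\<close> of the
  colourings; larger sets contain one of these.\<close>

lemma ex_colouring_with_triads:
  assumes "0 < j"
  obtains \<phi> where "\<And>S. S \<subseteq> {..<2 ^ j} \<Longrightarrow> 72 * j \<le> card S \<Longrightarrow>
    \<exists>x\<in>S. \<exists>y\<in>S. \<exists>z\<in>S. z < y \<and> y < x \<and> triad \<phi> x y z"
proof -
  define M :: nat where "M = 2 ^ j"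
  \<comment> \<open>Then \<open>t * t = 8 * (72 * j * j)\<close> and
    \<open>M ^ (3 * t) = 2 ^ (72 * j * j)\<close>, so the union bound reduces to
    \<open>2 * 7 ^ 8 < 8 ^ 8\<close>.\<close>
  define t where "t = 24 * j"
  define bad where "bad S = {G \<in> Pow ({..<M} \<times> {..<M}). \<not> (\<exists>x\<in>S. \<exists>y\<in>S. \<exists>z\<in>S. z < y \<and> y < x \<and>
      triad (\<lambda>u v. (u, v) \<in> G) x y z)}" for S :: "nat set"
  define \<S> where "\<S> = {S. S \<subseteq> {..<M} \<and> card S = 3 * t}"
  have fin: "finite \<S>" unfolding \<S>_def by (rule finite_subset[of _ "Pow {..<M}"]) auto
  have "card \<S> = M choose (3 * t)"
    using n_subsets[of "{..<M}" "3 * t"] by (simp add: \<S>_def)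
  also have "\<dots> \<le> M ^ (3 * t)"
    by (cases "3 * t \<le> M") (auto intro: binomial_le_pow simp: binomial_eq_0)
  finally have cS: "card \<S> \<le> M ^ (3 * t)" .
  have "card (\<Union>S\<in>\<S>. bad S) * 8 ^ (t * t) \<le> (\<Sum>S\<in>\<S>. card (bad S)) * 8 ^ (t * t)"
    using card_UN_le[OF fin] by (rule mult_le_mono1)
  also have "\<dots> \<le> (\<Sum>S\<in>\<S>. 7 ^ (t * t) * 2 ^ (M * M))"
    unfolding sum_distrib_right bad_def
    by (intro sum_mono card_triad_free_le) (auto simp: \<S>_def)
  also have "\<dots> \<le> M ^ (3 * t) * (7 ^ (t * t) * 2 ^ (M * M))"
    using cS by simp
  also have "\<dots> = (M ^ (3 * t) * 7 ^ (t * t)) * 2 ^ (M * M)"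
    by simp
  also have "\<dots> < 8 ^ (t * t) * 2 ^ (M * M)"
  proof -
    have "M ^ (3 * t) * 7 ^ (t * t) = (2 * 7 ^ 8) ^ (72 * j * j)"
    proof -
      have "M ^ (3 * t) = 2 ^ (72 * j * j)"
        by (simp add: M_def t_def ac_simps flip: power_mult)
      moreover have "(7::nat) ^ (t * t) = (7 ^ 8) ^ (72 * j * j)"
        unfolding power_mult[symmetric] by (simp add: t_def ac_simps)
      ultimately show ?thesis
        unfolding power_mult_distrib by simp
    qed
    also have "\<dots> < (8 ^ 8) ^ (72 * j * j)"
      using assms by (intro power_strict_mono) auto
    also have "\<dots> = 8 ^ (t * t)"
      unfolding power_mult[symmetric] by (simp add: t_def ac_simps)
    finally show ?thesis by simp
  qed
  finally have "card (\<Union>S\<in>\<S>. bad S) < card (Pow ({..<M} \<times> {..<M}))"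
    by (simp add: card_Pow card_cartesian_product mult.commute)
  moreover have "(\<Union>S\<in>\<S>. bad S) \<subseteq> Pow ({..<M} \<times> {..<M})"
    by (auto simp: bad_def)
  ultimately have "(\<Union>S\<in>\<S>. bad S) \<subset> Pow ({..<M} \<times> {..<M})"
    by (metis less_irrefl psubsetI)
  then obtain G where G: "G \<subseteq> {..<M} \<times> {..<M}" "\<And>S. S \<in> \<S> \<Longrightarrow> G \<notin> bad S"
    by (auto dest!: psubset_imp_ex_mem)
  show thesis
  proof (rule that)
    fix S :: "nat set" assume S: "S \<subseteq> {..<2 ^ j}" "72 * j \<le> card S"
    then obtain S' where "S' \<subseteq> S" "card S' = 72 * j"
      by (meson obtain_subset_with_card_n)
    then have "S' \<in> \<S>"
      using S by (auto simp: \<S>_def M_def t_def)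
    then have "\<exists>x\<in>S'. \<exists>y\<in>S'. \<exists>z\<in>S'. z < y \<and> y < x \<and> triad (\<lambda>u v. (u, v) \<in> G) x y z"
      using G(2)[of S'] G(1) unfolding bad_def by blast
    then show "\<exists>x\<in>S. \<exists>y\<in>S. \<exists>z\<in>S. z < y \<and> y < x \<and> triad (\<lambda>u v. (u, v) \<in> G) x y z"
      using \<open>S' \<subseteq> S\<close> by blast
  qed
qed

text \<open>The arguments \<open>p, q, r\<close> are the consecutive values of \<^const>\<open>delta\<close> on a quadruple; the branches are,
  in this order: left comb or balanced, right comb, and the two bent paths, with root \<open>p\<close> and \<open>r\<close>
  respectively. In \<open>\<phi> x y\<close> the larger label comes first.\<close>

definition red :: "(nat \<Rightarrow> nat \<Rightarrow> bool) \<Rightarrow> nat \<Rightarrow> nat \<Rightarrow> nat \<Rightarrow> bool" where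
  "red \<phi> p q r \<longleftrightarrow>
     (if p < q then if q < r then triad \<phi> r q p else \<phi> q p \<or> \<not> \<phi> q r
      else if r < q then triad \<phi> p q r
      else if r < p then \<phi> p r \<and> \<phi> p q \<and> \<not> \<phi> r q
      else \<not> \<phi> r p \<and> \<not> \<phi> r q \<and> \<phi> p q)"

text \<open>The first five premises are the gap triples of the quadruples of five vertices, the root
  label \<open>t\<close> separating the last vertex. If \<open>q < r\<close>, then
  \<open>p q t\<close> and \<open>q r t\<close> demand opposite values of \<open>\<phi> t q\<close>;
  if \<open>r < q\<close>, they force colours for which \<open>p q r\<close> is not red.\<close>

lemma red_no_4_1:
  assumes "red \<phi> p q r" "red \<phi> p q t" "red \<phi> p (max q r) t" "red \<phi> (max p q) r t" "red \<phi> q r t"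
    and "p < t" "q < t" "r < t" "p \<noteq> q" "q \<noteq> r" "q < p \<Longrightarrow> q < r \<Longrightarrow> p \<noteq> r"
  shows False
proof -
  have "p < q \<or> q < p" "q < r \<or> r < q" "p < r \<or> r < p \<or> p = r"
    using assms by auto
  then show False
    using assms by (elim disjE) (simp_all add: red_def triad_def max_def)
qed

text \<open>Here the root label \<open>p\<close> separates the first vertex. The triple
  \<open>p q r\<close> demands \<open>\<phi> p r\<close>, which \<open>p r t\<close> denies if
  \<open>t < r\<close>. If \<open>r < t\<close>, the triples with the root clash with each other or
  with \<open>q r t\<close>.\<close>

lemma red_no_1_4:
  assumes "red \<phi> p q r" "red \<phi> p q (max r t)" "red \<phi> p (max q r) t" "red \<phi> p r t" "red \<phi> q r t"
    and "q < p" "r < p" "t < p" "q \<noteq> r" "r \<noteq> t" "r < q \<Longrightarrow> r < t \<Longrightarrow> q \<noteq> t"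
  shows False
proof -
  have "q < r \<or> r < q" "r < t \<or> t < r" "q < t \<or> t < q \<or> q = t"
    using assms by auto
  then show False
    using assms by (elim disjE) (simp_all add: red_def triad_def max_def)
qed

text \<open>The root label \<open>r\<close> separates three vertices from three. Whatever the shapes
  of the two sides, \<open>p q r\<close> gives \<open>\<not> \<phi> r q\<close> and
  \<open>r s t\<close> gives \<open>\<phi> r t\<close>, so the balanced \<open>q r t\<close> is not
  red.\<close>

lemma red_no_3_3:
  assumes "red \<phi> p q r" "red \<phi> r s t"
    and "red \<phi> p r s" "red \<phi> p r t" "red \<phi> q r s" "red \<phi> q r t"
    and "p < r" "q < r" "s < r" "t < r" "p \<noteq> q" "s \<noteq> t"
  shows False
proof -
  have "p < q \<or> q < p" "s < t \<or> t < s"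
    using assms by auto
  then show False
    using assms by (elim disjE) (simp_all add: red_def triad_def)
qed

text \<open>If the balanced triples \<open>p q r\<close> and \<open>r s t\<close> both fail, either
  the bent path \<open>q r s\<close> is red, or its failure fixes the colour between
  \<open>q\<close> and \<open>s\<close> so that a balanced triple containing both is red.\<close>

lemma red_alternating:
  assumes "p < q" "r < q" "r < s" "t < s" "q \<noteq> s"
  shows "red \<phi> p q r \<or> red \<phi> r s t \<or> red \<phi> q r s \<or> (s < q \<and> red \<phi> p q s) \<or> (q < s \<and> red \<phi> q s t)"
proof -
  have "s < q \<or> q < s"
    using assms by auto
  then show ?thesis
    using assms by (elim disjE) (simp_all add: red_def, blast+)
qed

section \<open>No complete set on six vertices\<close>

definition quad :: "(nat \<Rightarrow> nat \<Rightarrow> bool) \<Rightarrow> nat list \<Rightarrow> bool" where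
  "quad \<phi> xs \<longleftrightarrow> red \<phi> (delta (xs ! 0) (xs ! 1)) (delta (xs ! 1) (xs ! 2)) (delta (xs ! 2) (xs ! 3))"

lemma quad_Cons [simp]: "quad \<phi> [a, b, c, d] = red \<phi> (delta a b) (delta b c) (delta c d)"
  by (simp add: quad_def eval_nat_numeral)

lemma quad_no_4_1:
  assumes "a < b" "b < c" "c < d" "d < e"
    and "quad \<phi> [a, b, c, d]" "quad \<phi> [a, b, c, e]" "quad \<phi> [a, b, d, e]"
      "quad \<phi> [a, c, d, e]" "quad \<phi> [b, c, d, e]"
  shows "\<not> (delta a b < delta d e \<and> delta b c < delta d e \<and> delta c d < delta d e)"
proof
  assume *: "delta a b < delta d e \<and> delta b c < delta d e \<and> delta c d < delta d e"
  then show False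
    using assms delta_max[of a b c] delta_max[of b c d] delta_max[of c d e]
      delta_neq[of a b c] delta_neq[of b c d] delta_valley_neq[of a b c d]
    by (intro red_no_4_1[of \<phi> "delta a b" "delta b c" "delta c d" "delta d e"]) auto
qed

lemma quad_no_1_4:
  assumes "a < b" "b < c" "c < d" "d < e"
    and "quad \<phi> [a, b, c, d]" "quad \<phi> [a, b, c, e]" "quad \<phi> [a, b, d, e]"
      "quad \<phi> [a, c, d, e]" "quad \<phi> [b, c, d, e]"
  shows "\<not> (delta b c < delta a b \<and> delta c d < delta a b \<and> delta d e < delta a b)"
proof
  assume *: "delta b c < delta a b \<and> delta c d < delta a b \<and> delta d e < delta a b"
  then show False
    using assms delta_max[of a b c] delta_max[of b c d] delta_max[of c d e]
      delta_neq[of b c d] delta_neq[of c d e] delta_valley_neq[of b c d e]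
    by (intro red_no_1_4[of \<phi> "delta a b" "delta b c" "delta c d" "delta d e"]) auto
qed

text \<open>The largest of the five gaps is the root label. Applied to five consecutive vertices,
  the 4-1 and 1-4 splits exclude every position but the middle one, and \<open>red_no_3_3\<close>
  excludes that.\<close>

lemma quad_no_6:
  assumes "sorted_wrt (<) [a, b, c, d, e, f]"
    and quad: "\<And>w x y z. {w, x, y, z} \<subseteq> {a, b, c, d, e, f} \<Longrightarrow> w < x \<Longrightarrow> x < y \<Longrightarrow> y < z \<Longrightarrow>
      quad \<phi> [w, x, y, z]"
  shows False
proof -
  have less: "a < b" "b < c" "c < d" "d < e" "e < f"
    using assms(1) by auto
  have no41: "\<not> (delta u v < delta x y \<and> delta v w < delta x y \<and> delta w x < delta x y)"
    if "sorted_wrt (<) [u, v, w, x, y]" "{u, v, w, x, y} \<subseteq> {a, b, c, d, e, f}" for u v w x y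
    using that by (intro quad_no_4_1[of _ _ _ _ _ \<phi>] quad) auto
  have no14: "\<not> (delta v w < delta u v \<and> delta w x < delta u v \<and> delta x y < delta u v)"
    if "sorted_wrt (<) [u, v, w, x, y]" "{u, v, w, x, y} \<subseteq> {a, b, c, d, e, f}" for u v w x y
    using that by (intro quad_no_1_4[of _ _ _ _ _ \<phi>] quad) auto
  define p q r s t where defs: "p = delta a b" "q = delta b c" "r = delta c d" "s = delta d e"
    "t = delta e f"
  have neq: "p \<noteq> q" "q \<noteq> r" "r \<noteq> s" "s \<noteq> t"
    using less by (simp_all add: defs delta_neq)
  have no: "\<not> (p < s \<and> q < s \<and> r < s)" "\<not> (q < t \<and> r < t \<and> s < t)"
    "\<not> (q < p \<and> r < p \<and> s < p)" "\<not> (r < q \<and> s < q \<and> t < q)"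
    unfolding defs using less by (intro no41 no14; simp)+
  \<comment> \<open>Two equal gaps must have a larger one between them; the instances collected here
    exclude ties for the maximum, so that the strict inequalities in \<open>no\<close>
    apply.\<close>
  have valley: "p \<noteq> r" if "q < r"
    using delta_valley_neq[of a b c d] that less by (simp add: defs)
  have valley': "q \<noteq> s" if "r < s"
    using delta_valley_neq[of b c d e] that less by (simp add: defs)
  have valley'': "r \<noteq> t" if "s < t"
    using delta_valley_neq[of c d e f] that less by (simp add: defs)
  have ps: "p \<noteq> s" if "q < s" "r < s"
    using delta_neq[of a b e] delta_max[of b c e] delta_max[of c d e] that less
    by (simp add: defs)
  have qt: "q \<noteq> t" if "r < t" "s < t"
    using delta_neq[of b c f] delta_max[of c d f] delta_max[of d e f] that less
    by (simp add: defs)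
  have "\<not> (q \<le> p \<and> r \<le> p \<and> s \<le> p \<and> t \<le> p)"
    using neq(1) no(3) valley ps by (metis le_neq_implies_less)
  moreover have "\<not> (p \<le> q \<and> r \<le> q \<and> s \<le> q \<and> t \<le> q)"
    using neq(2) no(4) valley' qt by (metis le_neq_implies_less)
  moreover have "\<not> (p \<le> s \<and> q \<le> s \<and> r \<le> s \<and> t \<le> s)"
    using neq(3) no(1) valley' ps by (metis le_neq_implies_less)
  moreover have "\<not> (p \<le> t \<and> q \<le> t \<and> r \<le> t \<and> s \<le> t)"
    using neq(4) no(2) valley'' qt by (metis le_neq_implies_less)
  ultimately have le: "p \<le> r \<and> q \<le> r \<and> s \<le> r \<and> t \<le> r"
    by linarith
  then have qs: "q < r" "s < r"
    using neq by auto
  then have pt: "p < r" "t < r"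
    using le valley[OF qs(1)] valley'' by (auto simp: le_less)
  note r = qs pt
  show False
  proof (rule red_no_3_3)
    show "red \<phi> p q r" "red \<phi> r s t"
      using quad[of a b c d] quad[of c d e f] less by (auto simp: defs)
    show "red \<phi> p r s" "red \<phi> p r t" "red \<phi> q r s" "red \<phi> q r t"
      using quad[of a b d e] quad[of a b e f] quad[of b c d e] quad[of b c e f]
        delta_max[of b c d] delta_max[of c d e] delta_max[of b d e] less r
      by (auto simp: defs)
  qed (use r neq in auto)
qed

section \<open>The 4-graph on \<open>2 ^ 2 ^ j\<close> vertices\<close>

lemma sorted_list_of_set_4:
  assumes "a < b" "b < c" "c < d"
  shows "sorted_list_of_set {a, b, c, d} = [a, b, c, d]"
proof -
  have "sorted_list_of_set (set [a, b, c, d]) = [a, b, c, d]"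
    using assms by (intro sorted_list_of_set.idem_if_sorted_distinct) auto
  then show ?thesis by (simp only: list.set)
qed

lemma avoids_4_6:
  assumes "0 < j"
  shows "avoids 4 6 (4 * (72 * j) + 2) (2 ^ 2 ^ j)"
proof -
  define N :: nat where "N = 2 ^ j"
  obtain \<phi> where \<phi>: "\<And>S. S \<subseteq> {..<N} \<Longrightarrow> 72 * j \<le> card S \<Longrightarrow>
    \<exists>x\<in>S. \<exists>y\<in>S. \<exists>z\<in>S. z < y \<and> y < x \<and> triad \<phi> x y z"
    using ex_colouring_with_triads[OF assms] unfolding N_def by metis
  define F where "F = {X \<in> [{..<2 ^ N}]\<^bsup>4\<^esup>. quad \<phi> (sorted_list_of_set X)}"
  have F_iff: "{a, b, c, d} \<in> F \<longleftrightarrow> {a, b, c, d} \<subseteq> {..<2 ^ N} \<and> quad \<phi> [a, b, c, d]"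
    if "a < b" "b < c" "c < d" for a b c d
    using that sorted_list_of_set_4[OF that] by (auto simp: F_def nsets_def)
  have no_clique: "\<not> [S]\<^bsup>4\<^esup> \<subseteq> F" if S: "S \<subseteq> {..<2 ^ N}" "card S = 6" for S
  proof
    assume sub: "[S]\<^bsup>4\<^esup> \<subseteq> F"
    have "finite S" using S finite_subset by blast
    define xs where "xs = sorted_list_of_set S"
    have xs: "sorted_wrt (<) xs" "set xs = S" "length xs = 6"
      using \<open>finite S\<close> S by (auto simp: xs_def)
    obtain a b c d e f where eq: "xs = [a, b, c, d, e, f]"
      using xs(3) by (auto simp: length_Suc_conv eval_nat_numeral)
    have "quad \<phi> [w, x, y, z]"
      if "{w, x, y, z} \<subseteq> {a, b, c, d, e, f}" "w < x" "x < y" "y < z" for w x y z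
    proof -
      have "{w, x, y, z} \<subseteq> S" using that(1) unfolding xs(2)[symmetric] eq by simp
      moreover have "card {w, x, y, z} = 4" using that by simp
      ultimately have "{w, x, y, z} \<in> F"
        using sub by (auto simp: nsets_def)
      then show ?thesis using F_iff that by blast
    qed
    then show False
      using quad_no_6[of a b c d e f \<phi>] xs(1) eq by blast
  qed
  have no_indep: "\<exists>e\<in>F. e \<subseteq> I" if I: "I \<subseteq> {..<2 ^ N}" "card I = 4 * (72 * j) + 2" for I
  proof -
    have "finite I" using I finite_subset by blast
    then show ?thesis
    proof (rule comb_or_alternating[of I "72 * j"])
      show "4 * (72 * j) + 2 \<le> card I" using I by simp
    next
      fix A assume A: "A \<subseteq> I" "comb A" "card A = 72 * j + 2"
      then have ne: "A \<noteq> {}" and finA: "finite A"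
        using \<open>finite I\<close> finite_subset by auto
      have "72 * j \<le> card (labels A)"
        using card_labels_comb[OF finA ne A(2)] A(3) by simp
      moreover have "labels A \<subseteq> {..<N}"
        using A I by (intro labels_subset) auto
      ultimately obtain x y z where xyz: "{x, y, z} \<subseteq> labels A" "z < y" "y < x" "triad \<phi> x y z"
        using \<phi>[of "labels A"] by auto
      then have card3: "card {x, y, z} = 3" by simp
      obtain Y where Y: "Y \<subseteq> A" "labels Y = {x, y, z}" "card Y = Suc (card {x, y, z})"
        using comb_sublabels[OF finA ne A(2) xyz(1)] by blast
      define ys where "ys = sorted_list_of_set Y"
      have ys: "sorted_wrt (<) ys" "set ys = Y" "length ys = 4"
        using finite_subset[OF Y(1) finA] Y(3) card3 by (auto simp: ys_def)
      obtain a b c d where eq: "ys = [a, b, c, d]"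
        using ys(3) by (auto simp: length_Suc_conv eval_nat_numeral)
      have less: "a < b" "b < c" "c < d" and Yeq: "Y = {a, b, c, d}"
        using ys(1,2) eq by auto
      have lab: "delta a b \<in> {x, y, z}" "delta b c \<in> {x, y, z}" "delta c d \<in> {x, y, z}"
        using less unfolding Y(2)[symmetric] labels_def Yeq by blast+
      have "comb Y" using comb_subset[OF A(2) Y(1)] .
      \<comment> \<open>The direction of the comb decides in which order its gaps run through
        \<open>x > y > z\<close>; \<open>red\<close> asks for the triad in both.\<close>
      then consider "delta b c < delta a b" "delta c d < delta b c"
        | "delta a b < delta b c" "delta b c < delta c d"
        using descendingD[of Y a b c] descendingD[of Y b c d] ascendingD[of Y a b c]
          ascendingD[of Y b c d] less Yeq by (auto simp: comb_def)
      then have "quad \<phi> [a, b, c, d]"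
      proof cases
        case 1
        then have "delta a b = x" "delta b c = y" "delta c d = z"
          using lab xyz(2,3) by auto
        then show ?thesis using xyz by (simp add: red_def)
      next
        case 2
        then have "delta a b = z" "delta b c = y" "delta c d = x"
          using lab xyz(2,3) by auto
        then show ?thesis using xyz by (simp add: red_def)
      qed
      moreover have "Y \<subseteq> {..<2 ^ N}" using Y(1) A(1) I(1) by blast
      ultimately have "Y \<in> F"
        using F_iff[OF less] by (simp add: Yeq)
      then show ?thesis using Y(1) A(1) by blast
    next
      fix w0 w1 w2 w3 w4 w5
      assume w: "{w0, w1, w2, w3, w4, w5} \<subseteq> I"
        "w0 < w1" "w1 < w2" "w2 < w3" "w3 < w4" "w4 < w5"
        "delta w0 w1 < delta w1 w2" "delta w2 w3 < delta w1 w2"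
        "delta w2 w3 < delta w3 w4" "delta w4 w5 < delta w3 w4"
      \<comment> \<open>Omitting \<open>w2\<close> or \<open>w3\<close> lets the adjacent peak label
        dominate, so triples containing both peaks next to each other occur as well.\<close>
      have "delta w1 w3 = delta w1 w2" "delta w2 w4 = delta w3 w4"
        using delta_max[of w1 w2 w3] delta_max[of w2 w3 w4] w by auto
      moreover have "delta w1 w2 \<noteq> delta w3 w4"
        using delta_valley_neq[of w1 w2 w3 w4] w by simp
      ultimately have "quad \<phi> [w0, w1, w2, w3] \<or> quad \<phi> [w2, w3, w4, w5] \<or>
          quad \<phi> [w1, w2, w3, w4] \<or> quad \<phi> [w0, w1, w2, w4] \<or> quad \<phi> [w1, w3, w4, w5]"
        using red_alternating[of "delta w0 w1" "delta w1 w2" "delta w2 w3" "delta w3 w4"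
          "delta w4 w5" \<phi>] w by auto
      then obtain a b c d where "quad \<phi> [a, b, c, d]" "a < b" "b < c" "c < d" "{a, b, c, d} \<subseteq> I"
        using w by auto
      then show ?thesis
        using F_iff[of a b c d] I by (intro bexI[of _ "{a, b, c, d}"]) auto
    qed
  qed
  show ?thesis
    unfolding avoids_def N_def[symmetric]
    by (rule exI[of _ F]) (use no_clique no_indep in \<open>auto simp: F_def\<close>)
qed

section \<open>The tower bound\<close>

lemma avoids_mono:
  assumes "avoids k s n N" "n \<le> m"
  shows "avoids k s m N"
proof -
  have "\<exists>J\<subseteq>I. card J = n" if "card I = m" for I :: "nat set"
    using that assms(2) obtain_subset_with_card_n by metis
  then show ?thesis
    using assms(1) unfolding avoids_def by (meson order_trans)
qed

text \<open>The minimum could be any \<open>R \<le> N\<close>, so the witness is restricted to its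
  first \<open>R\<close> vertices; induced subgraphs inherit both properties.\<close>

lemma ramsey_number_greater:
  assumes "avoids k s n N"
  shows "N < ramsey_number k s n"
proof (rule ccontr)
  define R where "R = ramsey_number k s n"
  assume "\<not> ?thesis"
  then have "R \<le> N" by (simp add: R_def)
  have "ramsey_property k s n R"
    unfolding R_def ramsey_number_def by (rule LeastI_ex[OF ramsey_property_exists])
  obtain E where E: "E \<subseteq> [{..<N}]\<^bsup>k\<^esup>"
    and clique: "\<And>S. S \<subseteq> {..<N} \<Longrightarrow> card S = s \<Longrightarrow> \<not> [S]\<^bsup>k\<^esup> \<subseteq> E"
    and indep: "\<And>I. I \<subseteq> {..<N} \<Longrightarrow> card I = n \<Longrightarrow> \<exists>e\<in>E. e \<subseteq> I"
    using assms unfolding avoids_def by blast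
  define E' where "E' = E \<inter> [{..<R}]\<^bsup>k\<^esup>"
  have sub: "{..<R} \<subseteq> {..<N}" using \<open>R \<le> N\<close> by auto
  have "uniform_hypergraph k {..<R} E'"
    by (simp add: uniform_hypergraph_def E'_def)
  then have "contains_complete k {..<R} E' s \<or> has_independent_set {..<R} E' n"
    using \<open>ramsey_property k s n R\<close> by (simp add: ramsey_property_def)
  then show False
  proof
    assume "contains_complete k {..<R} E' s"
    then obtain S where "S \<subseteq> {..<R}" "card S = s" "[S]\<^bsup>k\<^esup> \<subseteq> E"
      by (auto simp: contains_complete_def E'_def)
    then show False using clique[of S] sub by (meson subset_trans)
  next
    assume "has_independent_set {..<R} E' n"
    then obtain I where I: "I \<subseteq> {..<R}" "card I = n" "\<And>e. e \<in> E' \<Longrightarrow> \<not> e \<subseteq> I"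
      by (auto simp: has_independent_set_def independent_set_def)
    then obtain e where e: "e \<in> E" "e \<subseteq> I"
      using indep[of I] sub by (meson subset_trans)
    then have "e \<in> E'"
      using I E by (auto simp: E'_def nsets_def)
    then show False using I e by blast
  qed
qed

lemma twr_mono: "x \<le> y \<Longrightarrow> twr i x \<le> twr i y"
  by (induction i x rule: twr.induct) auto

text \<open>Keeping \<open>N\<close> in the statement matches the passage from \<open>N\<close> to
  \<open>2 ^ N\<close> with one more tower level; each step costs a factor 8 in
  \<open>c\<close>.\<close>

lemma eventually_avoids:
  assumes "4 \<le> k"
  shows "\<exists>c>0. \<forall>\<^sub>F n in sequentially. \<exists>N. twr (k - 1) (c * real n) \<le> real N \<and> avoids k (k + 2) n N"
  using assms
proof (induction k rule: dec_induct)
  case base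
  have "\<exists>N. twr 3 (1 / 600 * real n) \<le> real N \<and> avoids 4 6 n N" if "600 \<le> n" for n
  proof -
    \<comment> \<open>As \<open>288 = 4 * 72\<close>, this is the largest \<open>j\<close> for which
      \<open>avoids_4_6\<close> fits into \<open>n\<close>; the constant 600 absorbs the
      rounding.\<close>
    define j where "j = (n - 2) div 288"
    have j: "288 * j + 2 \<le> n" "n < 288 * j + 290" "0 < j"
      using that unfolding j_def by auto
    have "2 powr (1 / 600 * real n) \<le> 2 powr real j"
      using j that by (intro powr_mono) auto
    then have "twr 3 (1 / 600 * real n) \<le> 2 powr real (2 ^ j)"
      by (simp add: eval_nat_numeral powr_realpow)
    also have "\<dots> = real (2 ^ 2 ^ j)"
      by (subst powr_realpow) auto
    finally show ?thesis
      using avoids_mono[OF avoids_4_6[OF j(3)], of n] j(1) by (intro exI[of _ "2 ^ 2 ^ j"]) auto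
  qed
  then have "\<forall>\<^sub>F n in sequentially. \<exists>N. twr 3 (1 / 600 * real n) \<le> real N \<and> avoids 4 6 n N"
    by (auto simp: eventually_sequentially)
  then show ?case
    by (intro exI[of _ "1 / 600"]) simp
next
  case (step k)
  then obtain c n0 where c: "c > 0"
    and n0: "\<And>n. n0 \<le> n \<Longrightarrow> \<exists>N. twr (k - 1) (c * real n) \<le> real N \<and> avoids k (k + 2) n N"
    by (auto simp: eventually_sequentially)
  have "\<exists>N. twr k (c / 8 * real m) \<le> real N \<and> avoids (Suc k) (Suc k + 2) m N"
    if m: "4 * n0 + 2 * k + 12 \<le> m" for m
  proof -
    \<comment> \<open>The largest \<open>n\<close> with \<open>4 * n + 2 + k \<le> m\<close>; the
      lower bound on \<open>m\<close> secures \<open>n0 \<le> n\<close> and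
      \<open>m / 8 \<le> n\<close>.\<close>
    define n where "n = (m - 2 - k) div 4"
    have n: "4 * n + 2 + k \<le> m" "m < 4 * n + 6 + k" "n0 \<le> n"
      using m unfolding n_def by auto
    obtain N where N: "twr (k - 1) (c * real n) \<le> real N" "avoids k (k + 2) n N"
      using n0[OF n(3)] by blast
    have "real m / 8 \<le> real n"
      using n(2) m by simp
    then have "c / 8 * real m \<le> c * real n"
      using c mult_left_mono[of "real m / 8" "real n" c] by simp
    then have "twr (k - 1) (c / 8 * real m) \<le> real N"
      using N(1) twr_mono order_trans by blast
    moreover obtain i where "k = Suc (Suc i)"
      using that[of "k - 2"] step.hyps by auto
    ultimately have "twr k (c / 8 * real m) \<le> 2 powr real N"
      by simp
    also have "\<dots> = real (2 ^ N)"
      by (simp add: powr_realpow)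
    finally have "twr k (c / 8 * real m) \<le> real (2 ^ N)" .
    moreover have "avoids (Suc k) (Suc k + 2) m (2 ^ N)"
      using avoids_mono[OF avoids_Suc[OF N(2)] n(1)] step.hyps by simp
    ultimately show ?thesis by blast
  qed
  then show ?case
    using c by (intro exI[of _ "c / 8"]) (auto simp: eventually_sequentially)
qed

theorem corollary1p3:
  fixes k :: nat
  assumes "k \<ge> 4"
  shows "\<exists>c::real. c > 0 \<and>
    (\<forall>\<^sub>F n in sequentially. real (ramsey_number k (k + 2) n) \<ge> twr (k - 1) (c * real n))"
proof -
  obtain c where c: "c > 0"
    and ev: "\<forall>\<^sub>F n in sequentially. \<exists>N. twr (k - 1) (c * real n) \<le> real N \<and> avoids k (k + 2) n N"
    using eventually_avoids[OF assms] by blast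
  have "\<forall>\<^sub>F n in sequentially. real (ramsey_number k (k + 2) n) \<ge> twr (k - 1) (c * real n)"
    using ev by (rule eventually_mono) (use ramsey_number_greater in \<open>force intro: order_trans\<close>)
  then show ?thesis using c by blast
qed

end
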